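(* Let $k$ be an even positive integer. For every integer $n>0$, let $b=\lfloor \log_2 n\rfloor$ and $c=n+1-2^{b}$. Then $$a_k(n)=\frac{(2^b+c)^k+(2^b-c)^k-2c^k}{2^{b+1}}+a_k(c-1).$$
   Context: A P-position of the game of Nim with $k$ piles is a $k$-tuple $(p_1,\dots,p_k)$ of non-negative integers whose nim-sum $p_1\oplus\cdots\oplus p_k$ is $0$, where $\oplus$ denotes bitwise XOR. $a_k(m)$ denotes the number of P-positions with $k$ piles such that every pile has at most $m$ counters, for $m\ge0$ (so $a_k(0)=1$). *)

theory Defs
  imports Complex_Main
begin

unbundle bit_operations_syntax

definition nim_sum :: "nat list \<Rightarrow> nat" where
  "nim_sum ps = foldr (XOR) ps 0"

definition P_position :: "nat \<Rightarrow> nat list \<Rightarrow> bool" where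
  "P_position k ps \<longleftrightarrow> length ps = k \<and> nim_sum ps = 0"

definition num_P_positions :: "nat \<Rightarrow> nat \<Rightarrow> nat" where
  "num_P_positions k m = card {ps. P_position k ps \<and> (\<forall>p\<in>set ps. p \<le> m)}"

end

theory Submission
  imports Defs
begin

text \<open>
  Let N be the largest power of two with N \<le> n. Piles range over the low values {0..<N} and the
  high values {N..<N + c}. In a position with at least one low pile, that pile is determined by
  the others, so such positions with nim-sum x number one N-th of those whose count of high piles
  has the parity prescribed by the bit N of x. Positions without low piles correspond, the number
  of piles being even, to positions with all piles below c by deleting the bit N everywhere.
\<close>

text \<open>The target \<open>x\<close> is arbitrary because fixing the first pile \<open>p\<close>
  turns it into \<open>x XOR p\<close>; only the target 0 is wanted in the end.\<close>

fun xor_count :: "nat set \<Rightarrow> nat \<Rightarrow> nat \<Rightarrow> nat" where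
  "xor_count S 0 x = (if x = 0 then 1 else 0)"
| "xor_count S (Suc k) x = (\<Sum>p\<in>S. xor_count S k (x XOR p))"

lemma xor_nat_left_cancel: "x XOR (x XOR y) = (y :: nat)"
  by (simp flip: xor.assoc)

lemma xor_nat_eq_iff: "x XOR y = z \<longleftrightarrow> y = x XOR (z :: nat)"
  using xor_nat_left_cancel by metis

lemma card_lists_nim_sum:
  assumes "finite S"
  shows "card {ps. length ps = k \<and> set ps \<subseteq> S \<and> nim_sum ps = x} = xor_count S k x"
proof (induction k arbitrary: x)
  case 0
  have "{ps :: nat list. length ps = 0 \<and> set ps \<subseteq> S \<and> nim_sum ps = x} = (if x = 0 then {[]} else {})"
    by (auto simp: nim_sum_def)
  then show ?case by simp
next
  case (Suc k)
  let ?L = "\<lambda>k x. {ps. length ps = k \<and> set ps \<subseteq> S \<and> nim_sum ps = x}"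
  have fin: "finite (?L k x)" for x
    by (rule finite_subset[OF _ finite_lists_length_eq[OF assms, of k]]) auto
  have "?L (Suc k) x = (\<Union>p\<in>S. (#) p ` ?L k (x XOR p))"
  proof (intro set_eqI iffI)
    fix ps assume "ps \<in> ?L (Suc k) x"
    then obtain p qs where "ps = p # qs" "length qs = k" "p \<in> S" "set qs \<subseteq> S"
      "p XOR nim_sum qs = x"
      by (cases ps) (auto simp: nim_sum_def)
    then show "ps \<in> (\<Union>p\<in>S. (#) p ` ?L k (x XOR p))"
      by (auto simp: xor_nat_eq_iff xor.commute)
  next
    fix ps assume "ps \<in> (\<Union>p\<in>S. (#) p ` ?L k (x XOR p))"
    then show "ps \<in> ?L (Suc k) x"
      by (auto simp: nim_sum_def xor_nat_left_cancel xor.commute[of x])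
  qed
  also have "card \<dots> = (\<Sum>p\<in>S. card ((#) p ` ?L k (x XOR p)))"
    using assms fin by (intro card_UN_disjoint) auto
  also have "\<dots> = xor_count S (Suc k) x"
    by (simp add: card_image Suc.IH)
  finally show ?case .
qed

lemma num_P_positions_eq_xor_count: "num_P_positions k m = xor_count {..<Suc m} k 0"
proof -
  have "{ps. P_position k ps \<and> (\<forall>p\<in>set ps. p \<le> m)}
      = {ps. length ps = k \<and> set ps \<subseteq> {..<Suc m} \<and> nim_sum ps = 0}"
    by (auto simp: P_position_def less_Suc_eq_le)
  then show ?thesis
    by (simp add: num_P_positions_def card_lists_nim_sum)
qed

lemma xor_pow2_less: "(q :: nat) < 2 ^ b \<Longrightarrow> 2 ^ b XOR q = 2 ^ b + q"
proof -
  assume "q < 2 ^ b"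
  then have q: "take_bit b q = q" by (simp add: take_bit_nat_eq_self_iff)
  have "2 ^ b AND q = 0"
    by (rule bit_eqI) (metis bit_and_iff bit_exp_iff bit_take_bit_iff bit_0_eq bot_apply bot_bool_def less_irrefl q)
  then show ?thesis by (simp add: disjunctive_add_eq_xor)
qed

lemma drop_bit_eq_iff_nat: "drop_bit b x = h \<longleftrightarrow> x \<in> {h * 2 ^ b..<Suc h * 2 ^ b}" for x :: nat
  by (auto simp: drop_bit_eq_div div_nat_eqI dividend_less_times_div algebra_simps
      intro: div_nat_eqI)

lemma finite_drop_bit_fibre: "finite {y :: nat. drop_bit b y = h}"
  by (simp add: drop_bit_eq_iff_nat)

text \<open>XOR with \<open>p\<close> is an involution, and it permutes the aligned blocks of length
  \<open>2 ^ b\<close> as its higher bits dictate.\<close>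

lemma sum_drop_bit_fibre_xor:
  "(\<Sum>y | drop_bit b y = h. f (y XOR p)) = (\<Sum>y | drop_bit b y = h XOR drop_bit b p. f y)"
  for p :: nat
  by (rule sum.reindex_bij_witness[of _ "\<lambda>y. y XOR p" "\<lambda>y. y XOR p"])
     (auto simp: drop_bit_xor xor.assoc)

text \<open>This is how a low pile is determined by the others: as \<open>p\<close> runs over the
  low values, \<open>x XOR p\<close> meets each element of the block of \<open>x\<close>
  once.\<close>

lemma sum_below_pow2_xor:
  "(\<Sum>p<2 ^ b. f (x XOR p)) = (\<Sum>y | drop_bit b y = drop_bit b x. f y)" for x :: nat
proof -
  have "{..<2 ^ b} = {y :: nat. drop_bit b y = 0}"
    by (auto simp: drop_bit_eq_iff_nat)
  then show ?thesis
    using sum_drop_bit_fibre_xor[of f x b 0] by (simp add: xor.commute)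
qed

text \<open>With \<open>a\<close> low and \<open>c\<close> high values, bit \<open>b\<close> of the
  nim-sum is the parity of the number of high piles. The half-sum or half-difference of
  \<open>(a + c) ^ k\<close> and \<open>(a - c) ^ k\<close> extracts that parity.\<close>

lemma sum_xor_count_fibre:
  assumes "a \<le> 2 ^ b" "c \<le> 2 ^ b" "h < 2"
  shows "real (\<Sum>y | drop_bit b y = h. xor_count {2 ^ b - a..<2 ^ b + c} k y)
    = ((real a + real c) ^ k + (- 1) ^ h * (real a - real c) ^ k) / 2"
  using assms(3)
proof (induction k arbitrary: h)
  case 0
  have "(\<Sum>y | drop_bit b y = h. if y = 0 then 1 else 0) = (if h = 0 then 1 else 0 :: nat)"
    by (subst sum.delta[OF finite_drop_bit_fibre]) auto
  with 0 show ?case by (auto simp: less_2_cases_iff)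
next
  case (Suc k)
  define S where "S = {2 ^ b - a..<2 ^ b + c}"
  define T where "T h = (\<Sum>y | drop_bit b y = h. xor_count S k y)" for h
  have S: "S = {2 ^ b - a..<2 ^ b} \<union> {2 ^ b..<2 ^ b + c}"
    using assms by (auto simp: S_def)
  have low: "drop_bit b p = 0" if "p < 2 ^ b" for p :: nat
    using that by (simp add: drop_bit_eq_iff_nat)
  have high: "drop_bit b p = 1" if "2 ^ b \<le> p" "p < 2 ^ b + c" for p
    using that assms by (subst drop_bit_eq_iff_nat) auto
  have flip: "h XOR Suc 0 = Suc 0 - h"
    using Suc.prems by (auto simp: less_2_cases_iff)
  have "(\<Sum>y | drop_bit b y = h. xor_count S (Suc k) y)
      = (\<Sum>p\<in>S. \<Sum>y | drop_bit b y = h. xor_count S k (y XOR p))"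
    by (simp add: sum.swap[of _ S])
  also have "\<dots> = (\<Sum>p\<in>S. T (h XOR drop_bit b p))"
    by (simp add: sum_drop_bit_fibre_xor T_def)
  \<comment> \<open>A low first pile keeps the block of the nim-sum, a high one exchanges blocks 0
    and 1.\<close>
  also have "\<dots> = (\<Sum>p\<in>{2 ^ b - a..<2 ^ b}. T h) + (\<Sum>p\<in>{2 ^ b..<2 ^ b + c}. T (1 - h))"
    unfolding S by (subst sum.union_disjoint) (auto simp: low high flip intro!: arg_cong2[where f = "(+)"] sum.cong)
  also have "\<dots> = a * T h + c * T (1 - h)"
    using assms by simp
  finally have "real (\<Sum>y | drop_bit b y = h. xor_count S (Suc k) y) = a * real (T h) + c * real (T (1 - h))"
    by (simp only: of_nat_add of_nat_mult)
  moreover have T: "real (T h) = ((real a + real c) ^ k + (- 1) ^ h * (real a - real c) ^ k) / 2" if "h < 2" for h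
    unfolding T_def S_def by (rule Suc.IH[OF that])
  have "a * real (T h) + c * real (T (1 - h))
      = ((real a + real c) ^ Suc k + (- 1) ^ h * (real a - real c) ^ Suc k) / 2"
    using Suc.prems by (auto simp: T less_2_cases_iff field_simps)
  ultimately show ?case
    unfolding S_def by (rule trans)
qed

text \<open>The difference counts the lists with some low pile. The right side counts all lists of
  the prescribed parity, less the all-high ones: \<open>c ^ k\<close> of them if \<open>k\<close>
  has that parity, otherwise none.\<close>

lemma xor_count_diff_high:
  assumes "c \<le> 2 ^ b" "x < 2 ^ Suc b"
  shows "2 ^ b * (real (xor_count {..<2 ^ b + c} k x) - real (xor_count {2 ^ b..<2 ^ b + c} k x))
    = ((2 ^ b + real c) ^ k + (- 1) ^ drop_bit b x * (2 ^ b - real c) ^ k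
       - real c ^ k - (- 1) ^ drop_bit b x * (- real c) ^ k) / 2"
  using assms(2)
proof (induction k arbitrary: x)
  case 0
  then show ?case by simp
next
  case (Suc k)
  define S where "S = {..<2 ^ b + c}"
  define H where "H = {2 ^ b..<2 ^ b + c}"
  define h where "h = drop_bit b x"
  have h: "h < 2"
    using Suc.prems by (simp add: h_def drop_bit_eq_div less_mult_imp_div_less)
  have S: "S = {..<2 ^ b} \<union> H"
    by (auto simp: S_def H_def)
  define L where "L = (\<Sum>p<2 ^ b. xor_count S k (x XOR p))"
  have "xor_count S (Suc k) x = L + (\<Sum>p\<in>H. xor_count S k (x XOR p))"
    unfolding xor_count.simps L_def by (subst (1) S, subst sum.union_disjoint) (auto simp: H_def)
  \<comment> \<open>If the first pile is low, the rest is free up to parity and is counted by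
    \<open>L\<close>; if it is high, a low pile must occur among the rest, which is the induction
    hypothesis.\<close>
  then have "2 ^ b * (real (xor_count S (Suc k) x) - real (xor_count H (Suc k) x))
      = 2 ^ b * real L
        + (\<Sum>p\<in>H. 2 ^ b * (real (xor_count S k (x XOR p)) - real (xor_count H k (x XOR p))))"
    by (simp add: sum_subtractf sum_distrib_left algebra_simps)
  also have "real L = ((2 ^ b + real c) ^ k + (- 1) ^ h * (2 ^ b - real c) ^ k) / 2"
    using sum_xor_count_fibre[of "2 ^ b" b c h k] assms(1) h
    unfolding L_def sum_below_pow2_xor by (simp add: S_def h_def atLeast0LessThan)
  \<comment> \<open>A high \<open>p\<close> flips bit \<open>b\<close> of the target, hence the
    reversed signs.\<close>
  also have "(\<Sum>p\<in>H. 2 ^ b * (real (xor_count S k (x XOR p)) - real (xor_count H k (x XOR p))))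
      = (\<Sum>p\<in>H. ((2 ^ b + real c) ^ k - (- 1) ^ h * (2 ^ b - real c) ^ k
           - real c ^ k + (- 1) ^ h * (- real c) ^ k) / 2)"
  proof (rule sum.cong[OF refl])
    fix p assume "p \<in> H"
    then have p: "drop_bit b p = 1" "p < 2 ^ Suc b"
      using assms by (auto simp: H_def drop_bit_eq_iff_nat simp del: One_nat_def)
    have "take_bit (Suc b) (x XOR p) = x XOR p"
      using p Suc.prems by (simp only: take_bit_xor take_bit_nat_eq_self_iff[THEN iffD2])
    then have "x XOR p < 2 ^ Suc b"
      by (simp only: take_bit_nat_eq_self_iff)
    from Suc.IH[OF this] show
      "2 ^ b * (real (xor_count S k (x XOR p)) - real (xor_count H k (x XOR p)))
        = ((2 ^ b + real c) ^ k - (- 1) ^ h * (2 ^ b - real c) ^ k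
           - real c ^ k + (- 1) ^ h * (- real c) ^ k) / 2"
      using h p by (auto simp: S_def H_def drop_bit_xor less_2_cases_iff simp flip: h_def)
  qed
  finally show ?case
    by (simp add: S_def H_def h_def field_simps)
qed

text \<open>Deleting bit \<open>b\<close> from all \<open>k\<close> piles changes the nim-sum by
  \<open>2 ^ b\<close> exactly when \<open>k\<close> is odd; the odd case is kept for the
  induction.\<close>

lemma xor_count_high:
  assumes "c \<le> 2 ^ b"
  shows "xor_count {2 ^ b..<2 ^ b + c} k x
    = xor_count {..<c} k (x XOR (if even k then 0 else 2 ^ b))"
proof (induction k arbitrary: x)
  case 0
  then show ?case by simp
next
  case (Suc k)
  let ?s = "\<lambda>k. if even k then 0 else 2 ^ b :: nat"
  have eq: "(x XOR (2 ^ b + q)) XOR ?s k = (x XOR ?s (Suc k)) XOR q" if "q < c" for q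
  proof -
    have "2 ^ b + q = 2 ^ b XOR q"
      using that assms by (simp add: xor_pow2_less)
    then show ?thesis
      by (simp add: xor.assoc xor.commute xor.left_commute xor_nat_left_cancel)
  qed
  have "xor_count {2 ^ b..<2 ^ b + c} (Suc k) x
      = (\<Sum>q<c. xor_count {2 ^ b..<2 ^ b + c} k (x XOR (2 ^ b + q)))"
    unfolding xor_count.simps
    by (rule sum.reindex_bij_witness[of _ "\<lambda>q. 2 ^ b + q" "\<lambda>p. p - 2 ^ b"]) auto
  also have "\<dots> = xor_count {..<c} (Suc k) (x XOR ?s (Suc k))"
    unfolding xor_count.simps by (intro sum.cong refl, subst Suc.IH, subst eq) simp_all
  finally show ?case .
qed

theorem theorem17:
  fixes k n b c :: nat
  assumes "even k" and "k > 0" and "n > 0"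
    and "b = nat \<lfloor>log 2 (real n)\<rfloor>"
    and "c = n + 1 - 2 ^ b"
  shows "real (num_P_positions k n) =
    ((2 ^ b + real c) ^ k + (2 ^ b - real c) ^ k - 2 * real c ^ k) / 2 ^ (b + 1)
      + real (num_P_positions k (c - 1))"
proof -
  have "\<lfloor>log 2 (real n)\<rfloor> = int b"
    using assms by simp
  then have b: "2 ^ b \<le> n" "n < 2 ^ Suc b"
    using floor_log_nat_eq_powr_iff[of 2 n b] assms(3) by (simp_all add: powr_realpow add.commute)
  \<comment> \<open>Since \<open>c\<close> is positive, the truncated \<open>c - 1\<close> is a true
    predecessor: piles of at most \<open>c - 1\<close> are those below \<open>c\<close>.\<close>
  have c: "c \<le> 2 ^ b" "Suc n = 2 ^ b + c" "Suc (c - 1) = c"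
    using b assms(5) by auto
  have "2 ^ b * (real (num_P_positions k n) - real (num_P_positions k (c - 1)))
      = ((2 ^ b + real c) ^ k + (2 ^ b - real c) ^ k - 2 * real c ^ k) / 2"
    \<comment> \<open>For target 0 and even \<open>k\<close> all signs are positive, both all-high
      terms equal \<open>c ^ k\<close>, and the all-high positions number
      \<open>xor_count {..<c} k 0\<close>.\<close>
    using xor_count_diff_high[OF c(1), of 0 k] xor_count_high[OF c(1), of k 0] \<open>even k\<close>
    unfolding num_P_positions_eq_xor_count c(2,3) by simp
  then show ?thesis
    by (simp add: field_simps)
qed

end
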